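(* Let $\mathcal{G}=(\mathcal{V},\mathcal{F},\mathcal{E})$ be a double-edge factor graph (without single edges) representing the factorization $g(\boldsymbol{s},\tilde{\boldsymbol{s}})=\prod_{a\in\mathcal{F}}f_a(\boldsymbol{s}_{\partial a},\tilde{\boldsymbol{s}}_{\partial a})$. For each $(j,a)\in\mathcal{E}$ let $\mathcal{T}_{j,a}$ be a finite set and let $\hat\phi_{j,a}:\mathcal{T}_{j,a}^2\times\mathcal{S}_j^2\to\mathbb{C}$ and $\phi_{j,a}:\mathcal{S}_j^2\times\mathcal{T}_{j,a}^2\to\mathbb{C}$ be Hermitian functions such that $$\sum_{t,\tilde t\in\mathcal{T}_{j,a}}\phi_{j,a}(s,\tilde s;t,\tilde t)\,\hat\phi_{j,a}(t,\tilde t;s',\tilde s')=\delta_{s,s'}\,\delta_{\tilde s,\tilde s'}\qquad\forall s,\tilde s,s',\tilde s'\in\mathcal{S}_j .$$ Then the partition sum $Z(\mathcal{G})=\sum_{\boldsymbol{s},\tilde{\boldsymbol{s}}}\prod_{a\in\mathcal{F}}f_a(\boldsymbol{s}_{\partial a},\tilde{\boldsymbol{s}}_{\partial a})$ satisfies $$Z(\mathcal{G})=\sum_{\boldsymbol{t},\tilde{\boldsymbol{t}}}\ \prod_{a\in\mathcal{F}}\hat f_a(\boldsymbol{t}_{\partial a,a},\tilde{\boldsymbol{t}}_{\partial a,a})\ \prod_{j\in\mathcal{V}}\hat h_j(\boldsymbol{t}_{j,\partial j},\tilde{\boldsymbol{t}}_{j,\partial j}),$$ where the sum is over all $\boldsymbol{t}=(t_{j,a})_{(j,a)\in\mathcal{E}}$,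 $\tilde{\boldsymbol{t}}=(\tilde t_{j,a})_{(j,a)\in\mathcal{E}}$ with $t_{j,a},\tilde t_{j,a}\in\mathcal{T}_{j,a}$, and $$\hat f_a(\boldsymbol{t}_{\partial a,a},\tilde{\boldsymbol{t}}_{\partial a,a})=\sum_{\boldsymbol{s}_{\partial a},\tilde{\boldsymbol{s}}_{\partial a}}f_a(\boldsymbol{s}_{\partial a},\tilde{\boldsymbol{s}}_{\partial a})\prod_{j\in\partial a}\hat\phi_{j,a}(t_{j,a},\tilde t_{j,a};s_j,\tilde s_j),$$ $$\hat h_j(\boldsymbol{t}_{j,\partial j},\tilde{\boldsymbol{t}}_{j,\partial j})=\sum_{s_j,\tilde s_j}\prod_{a\in\partial j}\phi_{j,a}(s_j,\tilde s_j;t_{j,a},\tilde t_{j,a}).$$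
   Context: A double-edge factor graph (DeFG) without single edges is a finite bipartite graph $\mathcal{G}=(\mathcal{V},\mathcal{F},\mathcal{E}\subseteq\mathcal{V}\times\mathcal{F})$ together with a finite set (alphabet) $\mathcal{S}_j$ for each $j\in\mathcal{V}$ and, for each $a\in\mathcal{F}$ with set of neighbors $\partial a\subseteq\mathcal{V}$, a function $f_a(\boldsymbol{s}_{\partial a},\tilde{\boldsymbol{s}}_{\partial a})\in\mathbb{C}$ of $\boldsymbol{s}_{\partial a},\tilde{\boldsymbol{s}}_{\partial a}\in\prod_{j\in\partial a}\mathcal{S}_j$ whose associated matrix (row index $\boldsymbol{s}_{\partial a}$, column index $\tilde{\boldsymbol{s}}_{\partial a}$) is positive semidefinite. $\partial j\subseteq\mathcal{F}$ is the set of neighbors of $j\in\mathcal{V}$. A function $f(x_1,\dots,x_k;\tilde x_1,\dots,\tilde x_k)$ (with $x_i,\tilde x_i$ in the same set) is called Hermitian if $f(x_1,\dots,x_k;\tilde x_1,\dots,\tilde x_k)=\overline{f(\tilde x_1,\dots,\tilde x_k;x_1,\dots,x_k)}$; thus $\phi_{j,a}$ Hermitian means $\phi_{j,a}(s,\tilde s;t,\tilde t)=\overline{\phi_{j,a}(\tilde s,s;\tilde t,t)}$, and similarly for $\hat\phi_{j,a}$. Notation: $\boldsymbol{t}_{\partial a,a}=(t_{j,a})_{j\in\partial a}$, $\boldsymbol{t}_{j,\partial j}=(t_{j,a})_{a\in\partial j}$, and likewise with tildes. *)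

theory Defs
  imports Complex_Main "HOL-Library.FuncSet"
begin

text \<open>
  A function \<open>f(x\<^sub>1,\<dots>,x\<^sub>k; y\<^sub>1,\<dots>,y\<^sub>k)\<close> with \<open>x\<^sub>i\<close> and \<open>y\<^sub>i\<close> in the same set is viewed as a kernel on the
  product \<open>X\<close> of these sets; the tuples \<open>x\<close> and \<open>y\<close> may be pairs or functions in some \<open>PiE\<close>.
\<close>

definition hermitian_on :: "'x set \<Rightarrow> ('x \<Rightarrow> 'x \<Rightarrow> complex) \<Rightarrow> bool" where
  "hermitian_on X f \<longleftrightarrow> (\<forall>x\<in>X. \<forall>y\<in>X. f x y = cnj (f y x))"

definition psd_on :: "'x set \<Rightarrow> ('x \<Rightarrow> 'x \<Rightarrow> complex) \<Rightarrow> bool" where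
  "psd_on X f \<longleftrightarrow>
     hermitian_on X f \<and>
     (\<forall>v :: 'x \<Rightarrow> complex. 0 \<le> Re (\<Sum>x\<in>X. \<Sum>y\<in>X. cnj (v x) * f x y * v y))"

text \<open>
  Variable nodes and factor nodes live in separate types, so the graph is bipartite by construction.
  All alphabets are subsets of one type \<open>'s\<close>. Only the values of \<open>factor a\<close> on \<open>local_configs G a\<close>
  below are meaningful.
\<close>

record ('v, 'f, 's) defg =
  var_nodes :: "'v set"
  fac_nodes :: "'f set"
  edges :: "('v \<times> 'f) set"
  alphabet :: "'v \<Rightarrow> 's set"
  factor :: "'f \<Rightarrow> ('v \<Rightarrow> 's) \<Rightarrow> ('v \<Rightarrow> 's) \<Rightarrow> complex"

definition fac_nbrs :: "('v, 'f, 's) defg \<Rightarrow> 'f \<Rightarrow> 'v set" where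
  "fac_nbrs G a = {j. (j, a) \<in> edges G}"

definition var_nbrs :: "('v, 'f, 's) defg \<Rightarrow> 'v \<Rightarrow> 'f set" where
  "var_nbrs G j = {a. (j, a) \<in> edges G}"

definition configs :: "('v, 'f, 's) defg \<Rightarrow> ('v \<Rightarrow> 's) set" where
  "configs G = (\<Pi>\<^sub>E j\<in>var_nodes G. alphabet G j)"

definition local_configs :: "('v, 'f, 's) defg \<Rightarrow> 'f \<Rightarrow> ('v \<Rightarrow> 's) set" where
  "local_configs G a = (\<Pi>\<^sub>E j\<in>fac_nbrs G a. alphabet G j)"

locale double_edge_factor_graph =
  fixes G :: "('v, 'f, 's) defg"
  assumes finite_var_nodes: "finite (var_nodes G)"
    and finite_fac_nodes: "finite (fac_nodes G)"
    and edges_subset: "edges G \<subseteq> var_nodes G \<times> fac_nodes G"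
    and finite_alphabet: "j \<in> var_nodes G \<Longrightarrow> finite (alphabet G j)"
    and factor_psd: "a \<in> fac_nodes G \<Longrightarrow> psd_on (local_configs G a) (factor G a)"

definition global_function ::
  "('v, 'f, 's) defg \<Rightarrow> ('v \<Rightarrow> 's) \<Rightarrow> ('v \<Rightarrow> 's) \<Rightarrow> complex" where
  "global_function G s s' =
     (\<Prod>a\<in>fac_nodes G. factor G a (restrict s (fac_nbrs G a)) (restrict s' (fac_nbrs G a)))"

definition partition_sum :: "('v, 'f, 's) defg \<Rightarrow> complex" where
  "partition_sum G = (\<Sum>s\<in>configs G. \<Sum>s'\<in>configs G. global_function G s s')"

text \<open>
  \<open>transformed_factor\<close> is the transform of the factor at \<open>a\<close> by \<open>\<phi>hat\<close>; its arguments are families indexed by the variable nodes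
  adjacent to \<open>a\<close>; \<open>transformed_var\<close> is the new factor at the variable
  node \<open>j\<close>; its arguments are families indexed by the
  factor nodes adjacent to \<open>j\<close>.
\<close>

definition transformed_factor ::
  "('v, 'f, 's) defg \<Rightarrow> ('v \<Rightarrow> 'f \<Rightarrow> 't \<Rightarrow> 't \<Rightarrow> 's \<Rightarrow> 's \<Rightarrow> complex) \<Rightarrow>
   'f \<Rightarrow> ('v \<Rightarrow> 't) \<Rightarrow> ('v \<Rightarrow> 't) \<Rightarrow> complex" where
  "transformed_factor G \<phi>hat a t t' =
     (\<Sum>s\<in>local_configs G a. \<Sum>s'\<in>local_configs G a.
        factor G a s s' * (\<Prod>j\<in>fac_nbrs G a. \<phi>hat j a (t j) (t' j) (s j) (s' j)))"

definition transformed_var ::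
  "('v, 'f, 's) defg \<Rightarrow> ('v \<Rightarrow> 'f \<Rightarrow> 's \<Rightarrow> 's \<Rightarrow> 't \<Rightarrow> 't \<Rightarrow> complex) \<Rightarrow>
   'v \<Rightarrow> ('f \<Rightarrow> 't) \<Rightarrow> ('f \<Rightarrow> 't) \<Rightarrow> complex" where
  "transformed_var G \<phi> j t t' =
     (\<Sum>s\<in>alphabet G j. \<Sum>s'\<in>alphabet G j. \<Prod>a\<in>var_nbrs G j. \<phi> j a s s' (t a) (t' a))"

end

theory Submission
  imports Defs
begin

text \<open>
  Distribute the products over \<open>a\<close> and \<open>j\<close> on the right-hand side over the sums that define the
  transformed factors. This gives, besides \<open>t\<close>, a configuration \<open>s\<close> of the variable nodes and a
  separate copy \<open>u a\<close> of the local configuration at each factor node. Summing over \<open>t\<close> first, the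
  duality of \<open>\<phi>\<close> and \<open>\<phi>hat\<close> yields one delta per edge, and these deltas together force every
  \<open>u a\<close> to be the restriction of \<open>s\<close>.
\<close>

lemma prod_double_sum_PiE:
  fixes f :: "'a \<Rightarrow> 'b \<Rightarrow> 'c \<Rightarrow> 'd :: comm_semiring_1"
  assumes "finite A" and "\<And>x. x \<in> A \<Longrightarrow> finite (B x)" and "\<And>x. x \<in> A \<Longrightarrow> finite (C x)"
  shows "(\<Prod>x\<in>A. \<Sum>y\<in>B x. \<Sum>z\<in>C x. f x y z) =
         (\<Sum>g\<in>Pi\<^sub>E A B. \<Sum>h\<in>Pi\<^sub>E A C. \<Prod>x\<in>A. f x (g x) (h x))"
  using assms by (simp add: prod_sum_PiE)

text \<open>Configurations come in pairs (plain and primed), so sums are exchanged two at a time: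
  the sum over \<open>B\<close> passes the block over \<open>C\<close> and \<open>D\<close> first,
  then the sum over \<open>A\<close> does.\<close>

lemma double_sum_swap:
  fixes f :: "'a \<Rightarrow> 'b \<Rightarrow> 'c \<Rightarrow> 'd \<Rightarrow> 'e :: comm_monoid_add"
  shows "(\<Sum>a\<in>A. \<Sum>b\<in>B. \<Sum>c\<in>C. \<Sum>d\<in>D. f a b c d) = (\<Sum>c\<in>C. \<Sum>d\<in>D. \<Sum>a\<in>A. \<Sum>b\<in>B. f a b c d)"
proof -
  have "(\<Sum>a\<in>A. \<Sum>b\<in>B. \<Sum>c\<in>C. \<Sum>d\<in>D. f a b c d) = (\<Sum>a\<in>A. \<Sum>c\<in>C. \<Sum>d\<in>D. \<Sum>b\<in>B. f a b c d)"
    by (simp add: sum.swap[of _ _ B])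
  also have "\<dots> = (\<Sum>c\<in>C. \<Sum>d\<in>D. \<Sum>a\<in>A. \<Sum>b\<in>B. f a b c d)"
    by (simp add: sum.swap[of _ _ A])
  finally show ?thesis .
qed

lemma double_sum_mult_of_bool:
  fixes f :: "'a \<Rightarrow> 'b \<Rightarrow> 'c :: semiring_1"
  assumes "finite A" and "finite B" and "a \<in> A" and "b \<in> B"
  shows "(\<Sum>x\<in>A. \<Sum>y\<in>B. f x y * (of_bool (x = a) * of_bool (y = b))) = f a b"
proof -
  \<comment> \<open>Nested conditionals are the form in which the simplifier collapses a sum over a
    delta; the inner sum vanishes as a whole unless \<open>x = a\<close>.\<close>
  have "(\<Sum>x\<in>A. \<Sum>y\<in>B. f x y * (of_bool (x = a) * of_bool (y = b))) =
        (\<Sum>x\<in>A. if x = a then \<Sum>y\<in>B. if y = b then f x y else 0 else 0)"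
    by (intro sum.cong refl) (auto intro!: sum.cong)
  then show ?thesis
    using assms by simp
qed

lemma prod_of_bool:
  fixes P :: "'a \<Rightarrow> bool"
  assumes "finite A"
  shows "(\<Prod>x\<in>A. of_bool (P x)) = (of_bool (\<forall>x\<in>A. P x) :: 'b :: comm_semiring_1)"
  using assms by (induction A rule: finite_induct) auto

context double_edge_factor_graph
begin

lemma finite_edges: "finite (edges G)"
  using edges_subset finite_var_nodes finite_fac_nodes finite_subset by blast

lemma fac_nbrs_subset: "fac_nbrs G a \<subseteq> var_nodes G"
  using edges_subset by (auto simp: fac_nbrs_def)

lemma var_nbrs_subset: "var_nbrs G j \<subseteq> fac_nodes G"
  using edges_subset by (auto simp: var_nbrs_def)

lemma finite_configs: "finite (configs G)"
  unfolding configs_def by (intro finite_PiE finite_var_nodes finite_alphabet)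

lemma finite_local_configs: "finite (local_configs G a)"
  unfolding local_configs_def
  using fac_nbrs_subset finite_var_nodes finite_subset
  by (intro finite_PiE finite_alphabet) blast+

lemma restrict_in_local_configs:
  "s \<in> configs G \<Longrightarrow> restrict s (fac_nbrs G a) \<in> local_configs G a"
  using fac_nbrs_subset by (auto simp: configs_def local_configs_def PiE_iff)

text \<open>Each edge is counted once at its factor end. With \<open>prod_edges_by_var\<close>,
  which counts at the variable end, this brings the \<open>\<phi>hat\<close> and
  \<open>\<phi>\<close> products to the same index set, so that they can be paired edge by
  edge.\<close>

lemma prod_edges_by_fac:
  fixes f :: "'v \<Rightarrow> 'f \<Rightarrow> 'c :: comm_monoid_mult"
  shows "(\<Prod>a\<in>fac_nodes G. \<Prod>j\<in>fac_nbrs G a. f j a) = (\<Prod>(j, a)\<in>edges G. f j a)"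
proof -
  have "(\<Prod>a\<in>fac_nodes G. \<Prod>j\<in>fac_nbrs G a. f j a) =
        (\<Prod>(a, j)\<in>(SIGMA a:fac_nodes G. fac_nbrs G a). f j a)"
    using finite_fac_nodes finite_var_nodes fac_nbrs_subset finite_subset
    by (intro prod.Sigma) blast+
  also have "\<dots> = (\<Prod>(j, a)\<in>edges G. f j a)"
    using edges_subset
    by (intro prod.reindex_bij_witness[of _ prod.swap prod.swap]) (auto simp: fac_nbrs_def)
  finally show ?thesis .
qed

lemma prod_edges_by_var:
  fixes f :: "'v \<Rightarrow> 'f \<Rightarrow> 'c :: comm_monoid_mult"
  shows "(\<Prod>j\<in>var_nodes G. \<Prod>a\<in>var_nbrs G j. f j a) = (\<Prod>(j, a)\<in>edges G. f j a)"
proof -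
  have "(\<Prod>j\<in>var_nodes G. \<Prod>a\<in>var_nbrs G j. f j a) =
        (\<Prod>(j, a)\<in>(SIGMA j:var_nodes G. var_nbrs G j). f j a)"
    using finite_fac_nodes finite_var_nodes var_nbrs_subset finite_subset
    by (intro prod.Sigma) blast+
  also have "(SIGMA j:var_nodes G. var_nbrs G j) = edges G"
    using edges_subset by (auto simp: var_nbrs_def)
  finally show ?thesis .
qed

text \<open>The edges at \<open>a\<close> are indexed by \<open>fac_nbrs G a\<close>, so agreement
  on all edges makes \<open>u a\<close> coincide with \<open>s\<close> there. Extensionality is used
  twice: \<open>u a\<close> is fixed by its values on \<open>fac_nbrs G a\<close>, and
  \<open>u\<close> by its values on \<open>fac_nodes G\<close>.\<close>

lemma prod_edges_of_bool:
  assumes "u \<in> (\<Pi>\<^sub>E a\<in>fac_nodes G. local_configs G a)"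
  shows "(\<Prod>(j, a)\<in>edges G. of_bool (s j = u a j)) =
         (of_bool (u = (\<lambda>a\<in>fac_nodes G. restrict s (fac_nbrs G a))) :: 'c :: comm_semiring_1)"
proof -
  have "u = (\<lambda>a\<in>fac_nodes G. restrict s (fac_nbrs G a))"
    if eq: "\<forall>(j, a)\<in>edges G. s j = u a j"
  proof (rule extensionalityI[of _ "fac_nodes G"])
    fix a assume a: "a \<in> fac_nodes G"
    then have "u a \<in> extensional (fac_nbrs G a)"
      using assms by (auto simp: local_configs_def PiE_iff)
    then show "u a = (\<lambda>a\<in>fac_nodes G. restrict s (fac_nbrs G a)) a"
      using eq a by (auto simp: fac_nbrs_def intro!: extensionalityI[of "u a"])
  qed (use assms in \<open>auto simp: PiE_iff\<close>)
  moreover have "\<forall>(j, a)\<in>edges G. s j = u a j"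
    if "u = (\<lambda>a\<in>fac_nodes G. restrict s (fac_nbrs G a))"
    unfolding that using edges_subset by (auto simp: fac_nbrs_def)
  ultimately have "(\<forall>(j, a)\<in>edges G. s j = u a j) \<longleftrightarrow>
      u = (\<lambda>a\<in>fac_nodes G. restrict s (fac_nbrs G a))"
    by blast
  then show ?thesis
    using prod_of_bool[OF finite_edges, of "\<lambda>(j, a). s j = u a j"]
    by (simp add: case_prod_unfold)
qed

text \<open>Distributivity picks a local configuration at each factor node independently, so
  \<open>u a j\<close> and \<open>u b j\<close> may differ. The restrictions on \<open>t\<close> and
  \<open>t'\<close> drop out because only values at neighbors are read.\<close>

lemma prod_transformed_factor:
  "(\<Prod>a\<in>fac_nodes G. transformed_factor G \<phi>hat a
      (\<lambda>j\<in>fac_nbrs G a. t (j, a)) (\<lambda>j\<in>fac_nbrs G a. t' (j, a))) =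
   (\<Sum>u\<in>(\<Pi>\<^sub>E a\<in>fac_nodes G. local_configs G a). \<Sum>u'\<in>(\<Pi>\<^sub>E a\<in>fac_nodes G. local_configs G a).
      (\<Prod>a\<in>fac_nodes G. factor G a (u a) (u' a)) *
      (\<Prod>(j, a)\<in>edges G. \<phi>hat j a (t (j, a)) (t' (j, a)) (u a j) (u' a j)))"
  unfolding transformed_factor_def
  by (simp add: prod_double_sum_PiE finite_fac_nodes finite_local_configs prod.distrib
      flip: prod_edges_by_fac)

text \<open>Choosing one symbol for each variable node is the same as choosing a global
  configuration, so here all edges at \<open>j\<close> share the value \<open>s j\<close>.\<close>

lemma prod_transformed_var:
  "(\<Prod>j\<in>var_nodes G. transformed_var G \<phi> j
      (\<lambda>a\<in>var_nbrs G j. t (j, a)) (\<lambda>a\<in>var_nbrs G j. t' (j, a))) =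
   (\<Sum>s\<in>configs G. \<Sum>s'\<in>configs G.
      \<Prod>(j, a)\<in>edges G. \<phi> j a (s j) (s' j) (t (j, a)) (t' (j, a)))"
  unfolding transformed_var_def configs_def
  by (simp add: prod_double_sum_PiE finite_var_nodes finite_alphabet
      flip: prod_edges_by_var)

lemma sum_transformed_eq_partition_sum:
  assumes finT: "\<And>j a. (j, a) \<in> edges G \<Longrightarrow> finite (T j a)"
    and dual: "\<And>j a s1 s1' s2 s2'.
           \<lbrakk>(j, a) \<in> edges G; s1 \<in> alphabet G j; s1' \<in> alphabet G j;
             s2 \<in> alphabet G j; s2' \<in> alphabet G j\<rbrakk> \<Longrightarrow>
           (\<Sum>t\<in>T j a. \<Sum>t'\<in>T j a. \<phi> j a s1 s1' t t' * \<phi>hat j a t t' s2 s2') =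
           of_bool (s1 = s2) * of_bool (s1' = s2')"
  shows "(\<Sum>t\<in>(\<Pi>\<^sub>E (j, a)\<in>edges G. T j a). \<Sum>t'\<in>(\<Pi>\<^sub>E (j, a)\<in>edges G. T j a).
       (\<Prod>a\<in>fac_nodes G.
          transformed_factor G \<phi>hat a
            (\<lambda>j\<in>fac_nbrs G a. t (j, a)) (\<lambda>j\<in>fac_nbrs G a. t' (j, a))) *
       (\<Prod>j\<in>var_nodes G.
          transformed_var G \<phi> j
            (\<lambda>a\<in>var_nbrs G j. t (j, a)) (\<lambda>a\<in>var_nbrs G j. t' (j, a)))) =
     partition_sum G"
    (is "(\<Sum>t\<in>?T. \<Sum>t'\<in>?T. ?prods t t') = _")
proof -
  define U where "U = (\<Pi>\<^sub>E a\<in>fac_nodes G. local_configs G a)"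
  define F where "F u u' = (\<Prod>a\<in>fac_nodes G. factor G a (u a) (u' a))" for u u'
  define R where "R s = (\<lambda>a\<in>fac_nodes G. restrict s (fac_nbrs G a))" for s :: "'v \<Rightarrow> 's"
  \<comment> \<open>\<open>K\<close> collects everything that depends on \<open>t\<close> and
    \<open>t'\<close>, as a product with one term per edge.\<close>
  define K where "K s s' u u' t t' = (\<Prod>(j, a)\<in>edges G.
      \<phi> j a (s j) (s' j) (t (j, a)) (t' (j, a)) *
      \<phi>hat j a (t (j, a)) (t' (j, a)) (u a j) (u' a j))" for s s' u u' t t'
  have finU: "finite U"
    unfolding U_def by (intro finite_PiE finite_fac_nodes finite_local_configs)
  have RU: "R s \<in> U" if "s \<in> configs G" for s
    using that by (simp add: R_def U_def restrict_in_local_configs)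
  have K_sum: "(\<Sum>t\<in>?T. \<Sum>t'\<in>?T. K s s' u u' t t') = of_bool (u = R s) * of_bool (u' = R s')"
    if s: "s \<in> configs G" "s' \<in> configs G" and u: "u \<in> U" "u' \<in> U" for s s' u u'
  proof -
    have "(\<Sum>t\<in>?T. \<Sum>t'\<in>?T. K s s' u u' t t') =
        (\<Prod>(j, a)\<in>edges G. \<Sum>y\<in>T j a. \<Sum>y'\<in>T j a.
          \<phi> j a (s j) (s' j) y y' * \<phi>hat j a y y' (u a j) (u' a j))"
      \<comment> \<open>Distributivity read backwards: the entries of \<open>t\<close> and
        \<open>t'\<close> range independently over the edges, so the sum of products becomes a
        product of sums, one per edge.\<close>
      by (simp add: K_def case_prod_unfold prod_double_sum_PiE finT finite_edges)
    also have "\<dots> = (\<Prod>(j, a)\<in>edges G. of_bool (s j = u a j) * of_bool (s' j = u' a j))"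
    proof (intro prod.cong refl, clarify)
      fix j a assume e: "(j, a) \<in> edges G"
      then have "j \<in> var_nodes G" "a \<in> fac_nodes G" "j \<in> fac_nbrs G a"
        using edges_subset by (auto simp: fac_nbrs_def)
      then show "(\<Sum>y\<in>T j a. \<Sum>y'\<in>T j a.
            \<phi> j a (s j) (s' j) y y' * \<phi>hat j a y y' (u a j) (u' a j)) =
          of_bool (s j = u a j) * of_bool (s' j = u' a j)"
        using s u by (intro dual[OF e]) (auto simp: configs_def U_def local_configs_def PiE_iff)
    qed
    also have "\<dots> = of_bool (u = R s) * of_bool (u' = R s')"
      using u by (simp add: case_prod_unfold prod.distrib U_def R_def
          prod_edges_of_bool[unfolded case_prod_unfold])
    finally show ?thesis .
  qed
  have "?prods t t' = (\<Sum>s\<in>configs G. \<Sum>s'\<in>configs G. \<Sum>u\<in>U. \<Sum>u'\<in>U. F u u' * K s s' u u' t t')"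
    for t t'
    unfolding prod_transformed_factor prod_transformed_var
    unfolding F_def[symmetric] U_def[symmetric] K_def case_prod_unfold
    \<comment> \<open>The swap hits the right-hand side, which alone has four nested sums, and moves
      the sums over \<open>u\<close> and \<open>u'\<close> outermost to match the expanded
      product.\<close>
    by (subst double_sum_swap)
      (simp add: sum_distrib_left sum_distrib_right prod.distrib mult_ac)
  then have "(\<Sum>t\<in>?T. \<Sum>t'\<in>?T. ?prods t t') =
      (\<Sum>t\<in>?T. \<Sum>t'\<in>?T. \<Sum>s\<in>configs G. \<Sum>s'\<in>configs G. \<Sum>u\<in>U. \<Sum>u'\<in>U. F u u' * K s s' u u' t t')"
    by simp
  also have "\<dots> = (\<Sum>s\<in>configs G. \<Sum>s'\<in>configs G. \<Sum>u\<in>U. \<Sum>u'\<in>U.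
      F u u' * (\<Sum>t\<in>?T. \<Sum>t'\<in>?T. K s s' u u' t t'))"
    \<comment> \<open>The pair of sums over \<open>?T\<close> moves inward past the pairs over
      \<open>configs G\<close> and \<open>U\<close>; \<open>F u u'\<close> is constant in
      \<open>t\<close> and \<open>t'\<close> and can stand outside them.\<close>
    unfolding double_sum_swap[where A = ?T and B = ?T and C = "configs G" and D = "configs G"]
      double_sum_swap[where A = ?T and B = ?T and C = U and D = U] sum_distrib_left ..
  also have "\<dots> = (\<Sum>s\<in>configs G. \<Sum>s'\<in>configs G. F (R s) (R s'))"
    \<comment> \<open>\<open>sum.cong\<close> supplies the memberships that \<open>K_sum\<close>
      requires. The deltas then select \<open>u = R s\<close> and \<open>u' = R s'\<close>, which
      are in range by \<open>RU\<close>.\<close>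
    by (simp add: K_sum double_sum_mult_of_bool finU RU cong: sum.cong)
  also have "\<dots> = partition_sum G"
    by (simp add: partition_sum_def global_function_def F_def R_def)
  finally show ?thesis .
qed

end

theorem theorem2p20:
  fixes G :: "('v, 'f, 's) defg"
    and T :: "'v \<Rightarrow> 'f \<Rightarrow> 't set"
    and \<phi>hat :: "'v \<Rightarrow> 'f \<Rightarrow> 't \<Rightarrow> 't \<Rightarrow> 's \<Rightarrow> 's \<Rightarrow> complex"
    and \<phi> :: "'v \<Rightarrow> 'f \<Rightarrow> 's \<Rightarrow> 's \<Rightarrow> 't \<Rightarrow> 't \<Rightarrow> complex"
  assumes "double_edge_factor_graph G"
    and "\<And>j a. (j, a) \<in> edges G \<Longrightarrow> finite (T j a)"
    and "\<And>j a. (j, a) \<in> edges G \<Longrightarrow>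
           hermitian_on (T j a \<times> alphabet G j) (\<lambda>(t, s) (t', s'). \<phi>hat j a t t' s s')"
    and "\<And>j a. (j, a) \<in> edges G \<Longrightarrow>
           hermitian_on (alphabet G j \<times> T j a) (\<lambda>(s, t) (s', t'). \<phi> j a s s' t t')"
    and "\<And>j a s1 s1' s2 s2'.
           \<lbrakk>(j, a) \<in> edges G; s1 \<in> alphabet G j; s1' \<in> alphabet G j;
             s2 \<in> alphabet G j; s2' \<in> alphabet G j\<rbrakk> \<Longrightarrow>
           (\<Sum>t\<in>T j a. \<Sum>t'\<in>T j a. \<phi> j a s1 s1' t t' * \<phi>hat j a t t' s2 s2') =
           of_bool (s1 = s2) * of_bool (s1' = s2')"
  shows "partition_sum G =
    (\<Sum>t\<in>(\<Pi>\<^sub>E (j, a)\<in>edges G. T j a). \<Sum>t'\<in>(\<Pi>\<^sub>E (j, a)\<in>edges G. T j a).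
       (\<Prod>a\<in>fac_nodes G.
          transformed_factor G \<phi>hat a
            (\<lambda>j\<in>fac_nbrs G a. t (j, a)) (\<lambda>j\<in>fac_nbrs G a. t' (j, a))) *
       (\<Prod>j\<in>var_nodes G.
          transformed_var G \<phi> j
            (\<lambda>a\<in>var_nbrs G j. t (j, a)) (\<lambda>a\<in>var_nbrs G j. t' (j, a))))"
  using double_edge_factor_graph.sum_transformed_eq_partition_sum[OF assms(1,2,5)] by simp

end
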